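(* Let $\mathbb{T}=\mathbb{S}^1(\tfrac12)\times\mathbb{S}^1(\tfrac12)$, let $\Phi:\mathbb{T}\to\mathbb{S}^4\subset\mathbb{R}^5$ be $\Phi(\gamma,\vartheta)=\big(\tfrac12\cos\gamma,\tfrac12\sin\gamma,\tfrac12\cos\vartheta,\tfrac12\sin\vartheta,\tfrac1{\sqrt2}\big)$ and let $V_\nu=\tfrac1{\sqrt2}(\cos\gamma,\sin\gamma,-\cos\vartheta,-\sin\vartheta,0)$. Let $\Phi_t:\mathbb{T}\to\mathbb{S}^4\subset\mathbb{R}^5$ be defined by $$\Phi_t=\frac{1}{\sqrt{1+t^2}}\,(\Phi+tV_\nu).$$ Then $\partial\Phi_t/\partial t\big|_{t=0}=V_\nu$ and $$\frac{d^\ell}{dt^\ell}\Big|_{t=0}E_2(\Phi_t)=0,\quad \ell=1,2,3,\qquad \frac{d^4}{dt^4}\Big|_{t=0}E_2(\Phi_t)=-48\pi^2<0 .$$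
   Context: $\mathbb{S}^n(R)$ is the Euclidean $n$-sphere of radius $R$, $\mathbb{S}^n=\mathbb{S}^n(1)$; $\mathbb{T}$ carries the product metric $\frac14(d\gamma^2+d\vartheta^2)$ in the angular coordinates $\gamma,\vartheta\in[0,2\pi]$. For a smooth map $\phi:(M,g)\to(N,h)$ with $M$ compact, the tension field is $\tau(\phi)=\mathrm{trace}\,\nabla d\phi$ and the bienergy is $E_2(\phi)=\frac12\int_M|\tau(\phi)|^2\,dv_M$. *)

theory Defs
  imports "HOL-Analysis.Analysis"
begin

text \<open>
  Riemannian notions for a domain described in coordinates by a metric
  \<open>g :: real^'m \<Rightarrow> real^'m^'m\<close> (the symmetric matrix of the metric coefficients) and for a target
  \<open>N\<close> that is a submanifold of a Euclidean space, with the induced metric.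
\<close>

definition partial :: "'m::finite \<Rightarrow> (real^'m \<Rightarrow> 'b::real_normed_vector) \<Rightarrow> real^'m \<Rightarrow> 'b" where
  "partial i f u = vector_derivative (\<lambda>s. f (u + s *\<^sub>R axis i 1)) (at 0)"

definition christoffel ::
    "(real^'m \<Rightarrow> real^'m^'m) \<Rightarrow> 'm::finite \<Rightarrow> 'm \<Rightarrow> 'm \<Rightarrow> real^'m \<Rightarrow> real" where
  "christoffel g k i j u =
     (1/2) * (\<Sum>l\<in>UNIV. matrix_inv (g u) $ k $ l *
        (partial i (\<lambda>v. g v $ j $ l) u + partial j (\<lambda>v. g v $ i $ l) u
         - partial l (\<lambda>v. g v $ i $ j) u))"

text \<open>Velocities at \<open>p\<close> of curves lying in \<open>N\<close>.\<close>

definition tangent_space :: "'b::real_inner set \<Rightarrow> 'b \<Rightarrow> 'b set" where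
  "tangent_space N p =
     {v. \<exists>c :: real \<Rightarrow> 'b. (\<forall>s. c s \<in> N) \<and> c 0 = p \<and> (c has_vector_derivative v) (at 0)}"

definition tangential_part :: "'b::real_inner set \<Rightarrow> 'b \<Rightarrow> 'b \<Rightarrow> 'b" where
  "tangential_part N p v =
     (THE w. w \<in> tangent_space N p \<and> (\<forall>z\<in>tangent_space N p. (v - w) \<bullet> z = 0))"

text \<open>
  The Levi-Civita connection of a submanifold of a Euclidean space is the tangential part of the
  flat connection.  Accordingly, for a vector field \<open>Y\<close> along \<open>f\<close>, that is
  \<open>Y u \<in> tangent_space N (f u)\<close>, the following is its covariant derivative in the \<open>i\<close>-th coordinate
  direction for the pull-back connection on \<open>f\<^sup>-\<^sup>1 TN\<close>.
\<close>

definition pullback_connection ::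
    "'b::real_inner set \<Rightarrow> (real^'m \<Rightarrow> 'b) \<Rightarrow> 'm::finite \<Rightarrow> (real^'m \<Rightarrow> 'b) \<Rightarrow> real^'m \<Rightarrow> 'b" where
  "pullback_connection N f i Y u = tangential_part N (f u) (partial i Y u)"

text \<open>\<open>(\<nabla>df)(\<partial>\<^sub>i, \<partial>\<^sub>j) = \<nabla>\<^sub>i (df(\<partial>\<^sub>j)) - df(\<nabla>\<^sub>i \<partial>\<^sub>j)\<close>\<close>

definition nabla_d ::
    "(real^'m \<Rightarrow> real^'m^'m) \<Rightarrow> 'b::real_inner set \<Rightarrow> (real^'m \<Rightarrow> 'b)
      \<Rightarrow> 'm::finite \<Rightarrow> 'm \<Rightarrow> real^'m \<Rightarrow> 'b" where
  "nabla_d g N f i j u =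
     pullback_connection N f i (partial j f) u
     - (\<Sum>k\<in>UNIV. christoffel g k i j u *\<^sub>R partial k f u)"

definition tension_field ::
    "(real^'m \<Rightarrow> real^'m^'m) \<Rightarrow> 'b::real_inner set \<Rightarrow> (real^'m \<Rightarrow> 'b)
      \<Rightarrow> real^'m::finite \<Rightarrow> 'b" where
  "tension_field g N f u =
     (\<Sum>i\<in>UNIV. \<Sum>j\<in>UNIV. matrix_inv (g u) $ i $ j *\<^sub>R nabla_d g N f i j u)"

text \<open>
  The bienergy, where the coordinates restricted to \<open>D\<close> parametrise the compact domain manifold
  bijectively up to null sets, so that the Riemannian measure is \<open>sqrt (det g)\<close> times Lebesgue
  measure on \<open>D\<close>.
\<close>

definition bienergy ::
    "(real^'m \<Rightarrow> real^'m^'m) \<Rightarrow> (real^'m) set \<Rightarrow> 'b::real_inner set \<Rightarrow> (real^'m::finite \<Rightarrow> 'b)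
      \<Rightarrow> real" where
  "bienergy g D N f =
     (1/2) * integral D (\<lambda>u. (norm (tension_field g N f u))\<^sup>2 * sqrt (det (g u)))"

type_synonym torus_ambient = "(real^2) \<times> (real^2)"

definition torus :: "torus_ambient set" where
  "torus = sphere 0 (1/2) \<times> sphere 0 (1/2)"

definition torus_point :: "real^2 \<Rightarrow> torus_ambient" where
  "torus_point u =
     (vector [(1/2) * cos (u $ 1), (1/2) * sin (u $ 1)],
      vector [(1/2) * cos (u $ 2), (1/2) * sin (u $ 2)])"

text \<open>The product metric \<open>(d\<gamma>\<^sup>2 + d\<theta>\<^sup>2) / 4\<close>.\<close>

definition torus_metric :: "real^2 \<Rightarrow> real^2^2" where
  "torus_metric u = (\<chi> i j. if i = j then 1/4 else 0)"

text \<open>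
  A map on the torus is differentiated through its expression in the angular coordinates.
\<close>

definition torus_bienergy :: "'b::real_inner set \<Rightarrow> (torus_ambient \<Rightarrow> 'b) \<Rightarrow> real" where
  "torus_bienergy N \<phi> =
     bienergy torus_metric (cbox (vector [0, 0]) (vector [2 * pi, 2 * pi])) N (\<phi> \<circ> torus_point)"

end

theory Submission
  imports Defs
begin

text \<open>
  Each \<open>\<Phi>\<^sub>t\<close> has the form \<open>(A cos \<gamma>, A sin \<gamma>, B cos \<theta>, B sin \<theta>, C)\<close> with \<open>A\<^sup>2 + B\<^sup>2 + C\<^sup>2 = 1\<close> and
  \<open>C\<^sup>2 = 1 / (2 (1 + t\<^sup>2))\<close>.  The Christoffel symbols vanish, so its tension field is four times the
  part of the coordinate Laplacian orthogonal to the map, and has the constant squared norm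
  \<open>16 C\<^sup>2 (1 - C\<^sup>2)\<close>.  Integrating gives \<open>E t = 2 \<pi>\<^sup>2 (1 + 2 t\<^sup>2) / (1 + t\<^sup>2)\<^sup>2\<close>, which equals
  \<open>2 \<pi>\<^sup>2 (1 - t\<^sup>4 / (1 + t\<^sup>2)\<^sup>2)\<close> and is therefore flat to third order at \<open>0\<close>.
\<close>

section \<open>Tangent spaces of the unit sphere and the tangential projection\<close>

lemma has_vector_derivative_normalized_line:
  fixes p v :: "'b::real_normed_vector"
  shows "((\<lambda>s. (1 / sqrt (1 + s\<^sup>2 * k)) *\<^sub>R (p + s *\<^sub>R v)) has_vector_derivative v) (at 0)"
proof -
  \<comment> \<open>The scaling factor is even in \<open>s\<close>, so it is 1 to first order and
    the velocity at 0 is that of the unnormalized line.\<close>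
  have "((\<lambda>s. 1 / sqrt (1 + s\<^sup>2 * k)) has_real_derivative 0) (at 0)"
    by (rule derivative_eq_intros refl | simp)+
  moreover have "((\<lambda>s. p + s *\<^sub>R v) has_vector_derivative v) (at 0)"
    by (auto intro!: derivative_eq_intros)
  ultimately show ?thesis
    using has_vector_derivative_scaleR by fastforce
qed

text \<open>Differentiating \<open>c s \<bullet> c s = 1\<close> makes every velocity orthogonal to
  \<open>p\<close>; conversely, the line through \<open>p\<close> in an orthogonal direction can be
  pushed radially back to the sphere.\<close>

lemma tangent_space_sphere:
  fixes p :: "'b::real_inner"
  assumes "norm p = 1"
  shows "tangent_space (sphere 0 1) p = {v. p \<bullet> v = 0}"
proof (intro equalityI subsetI)
  fix v assume "v \<in> tangent_space (sphere 0 1) p"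
  then obtain c where c: "\<And>s. norm (c s) = 1" "c 0 = p" "(c has_vector_derivative v) (at 0)"
    by (auto simp: tangent_space_def)
  have "((\<lambda>s. c s \<bullet> c s) has_real_derivative (2 * (p \<bullet> v))) (at (0::real))"
    using c(3) unfolding has_field_derivative_def has_vector_derivative_def
    by (auto intro!: derivative_eq_intros simp: c(2) inner_commute fun_eq_iff)
  moreover have "(\<lambda>s. c s \<bullet> c s) = (\<lambda>s. 1)"
    using c(1) by (simp add: dot_square_norm)
  ultimately show "v \<in> {v. p \<bullet> v = 0}"
    using DERIV_unique[of "\<lambda>s. 1" _ 0 0] by fastforce
next
  fix v assume "v \<in> {v. p \<bullet> v = 0}"
  then have pv: "p \<bullet> v = 0" "v \<bullet> p = 0" by (auto simp: inner_commute)
  have pp: "p \<bullet> p = 1" using assms by (simp add: dot_square_norm)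
  \<comment> \<open>Since \<open>p\<close> and \<open>v\<close> are orthogonal, the root is exactly
    the norm of \<open>p + s *\<^sub>R v\<close>, and it never vanishes.\<close>
  define c where "c s = (1 / sqrt (1 + s\<^sup>2 * (v \<bullet> v))) *\<^sub>R (p + s *\<^sub>R v)" for s
  have pos: "1 + s\<^sup>2 * (v \<bullet> v) > 0" for s :: real
    by (simp add: add_pos_nonneg)
  have "(norm (c s))\<^sup>2 = 1" for s
  proof -
    have "(norm (p + s *\<^sub>R v))\<^sup>2 = 1 + s\<^sup>2 * (v \<bullet> v)"
      using pp unfolding power2_norm_eq_inner
      by (simp add: inner_add_left inner_add_right pv power2_eq_square)
    then show ?thesis
      using pos[of s] by (simp add: c_def power_mult_distrib power_divide)
  qed
  then have "c s \<in> sphere 0 1" for s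
    by (metis mem_sphere_0 norm_ge_zero one_power2 power2_eq_imp_eq zero_le_one)
  moreover have "c 0 = p" by (simp add: c_def)
  moreover have "(c has_vector_derivative v) (at 0)"
    unfolding c_def by (rule has_vector_derivative_normalized_line)
  ultimately show "v \<in> tangent_space (sphere 0 1) p"
    by (auto simp: tangent_space_def)
qed

lemma tangential_part_sphere:
  fixes p :: "'b::real_inner"
  assumes "norm p = 1"
  shows "tangential_part (sphere 0 1) p v = v - (v \<bullet> p) *\<^sub>R p"
  unfolding tangential_part_def tangent_space_sphere[OF assms]
proof (rule the_equality)
  have pp: "p \<bullet> p = 1" using assms by (simp add: dot_square_norm)
  show "v - (v \<bullet> p) *\<^sub>R p \<in> {v. p \<bullet> v = 0} \<and>
      (\<forall>z\<in>{v. p \<bullet> v = 0}. (v - (v - (v \<bullet> p) *\<^sub>R p)) \<bullet> z = 0)"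
    by (simp add: inner_diff_right pp inner_commute)
  fix w assume w: "w \<in> {v. p \<bullet> v = 0} \<and> (\<forall>z\<in>{v. p \<bullet> v = 0}. (v - w) \<bullet> z = 0)"
  \<comment> \<open>The difference of two candidates is tangent, and it is also orthogonal to all
    tangent vectors, so it is orthogonal to itself.\<close>
  define d where "d = v - (v \<bullet> p) *\<^sub>R p - w"
  have pd: "p \<bullet> d = 0"
    using w by (simp add: d_def inner_diff_right pp inner_commute)
  then have "(v - w) \<bullet> d = 0" using w by blast
  moreover have "v - w = d + (v \<bullet> p) *\<^sub>R p" by (simp add: d_def)
  ultimately have "d \<bullet> d = 0" using pd by (simp add: inner_add_left)
  then show "w = v - (v \<bullet> p) *\<^sub>R p" by (simp add: d_def)
qed

section \<open>Coordinates in \<open>real^5\<close>\<close>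

lemma exhaust_5:
  fixes x :: 5
  shows "x = 1 \<or> x = 2 \<or> x = 3 \<or> x = 4 \<or> x = 5"
proof (induct x)
  case (of_int z)
  then have "0 \<le> z" and "z < 5" by simp_all
  then have "z = 0 \<or> z = 1 \<or> z = 2 \<or> z = 3 \<or> z = 4" by arith
  then show ?case by auto
qed

lemma forall_5: "(\<forall>i::5. P i) \<longleftrightarrow> P 1 \<and> P 2 \<and> P 3 \<and> P 4 \<and> P 5"
  by (metis exhaust_5)

lemma UNIV_5: "UNIV = {1, 2, 3, 4, 5::5}"
  using exhaust_5 by auto

lemma sum_5: "sum f (UNIV::5 set) = f 1 + f 2 + f 3 + f 4 + f 5"
  unfolding UNIV_5 by (simp add: ac_simps)

lemma vector_5 [simp]:
  "(vector [a, b, c, d, e] :: ('a::zero)^5) $ 1 = a"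
  "(vector [a, b, c, d, e] :: ('a::zero)^5) $ 2 = b"
  "(vector [a, b, c, d, e] :: ('a::zero)^5) $ 3 = c"
  "(vector [a, b, c, d, e] :: ('a::zero)^5) $ 4 = d"
  "(vector [a, b, c, d, e] :: ('a::zero)^5) $ 5 = e"
  unfolding vector_def by auto

lemma vec5_eq_iff:
  fixes x y :: "'a^5"
  shows "x = y \<longleftrightarrow> x$1 = y$1 \<and> x$2 = y$2 \<and> x$3 = y$3 \<and> x$4 = y$4 \<and> x$5 = y$5"
  by (simp add: vec_eq_iff forall_5)

lemma inner_vec5:
  fixes x y :: "real^5"
  shows "x \<bullet> y = x$1 * y$1 + x$2 * y$2 + x$3 * y$3 + x$4 * y$4 + x$5 * y$5"
  unfolding inner_vec_def sum_5 inner_real_def ..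

lemma has_vector_derivative_vector5:
  assumes "(a has_real_derivative a') (at x)" "(b has_real_derivative b') (at x)"
    "(c has_real_derivative c') (at x)" "(d has_real_derivative d') (at x)"
    "(e has_real_derivative e') (at x)"
  shows "((\<lambda>s. vector [a s, b s, c s, d s, e s] :: real^5) has_vector_derivative
    vector [a', b', c', d', e']) (at x)"
proof -
  \<comment> \<open>Expanding in constant axis vectors reduces the claim to the rules for sums and
    scalings.\<close>
  have *: "(vector [a1, a2, a3, a4, a5] :: real^5) =
      a1 *\<^sub>R axis 1 1 + a2 *\<^sub>R axis 2 1 + a3 *\<^sub>R axis 3 1 + a4 *\<^sub>R axis 4 1 + a5 *\<^sub>R axis 5 1"
    for a1 a2 a3 a4 a5
    by (simp add: vec5_eq_iff axis_def)
  show ?thesis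
    unfolding * by (auto intro!: derivative_eq_intros assms)
qed

section \<open>Tension field and bienergy of maps with two circular components\<close>

definition torus_map :: "real \<Rightarrow> real \<Rightarrow> real \<Rightarrow> real^2 \<Rightarrow> real^5" where
  "torus_map A B C u = vector [A * cos (u$1), A * sin (u$1), B * cos (u$2), B * sin (u$2), C]"

lemma norm_torus_map: "(norm (torus_map A B C u))\<^sup>2 = A\<^sup>2 + B\<^sup>2 + C\<^sup>2"
proof -
  have "(norm (torus_map A B C u))\<^sup>2 =
      A\<^sup>2 * ((cos (u$1))\<^sup>2 + (sin (u$1))\<^sup>2) + B\<^sup>2 * ((cos (u$2))\<^sup>2 + (sin (u$2))\<^sup>2) + C\<^sup>2"
    unfolding power2_norm_eq_inner inner_vec5 torus_map_def
    by (simp only: vector_5 power2_eq_square[symmetric] power_mult_distrib distrib_left add.assoc)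
  then show ?thesis by simp
qed

lemma torus_map_in_sphere: "A\<^sup>2 + B\<^sup>2 + C\<^sup>2 = 1 \<Longrightarrow> torus_map A B C u \<in> sphere 0 1"
  using norm_torus_map[of A B C u] by (simp add: power2_eq_1_iff) (smt (verit) norm_ge_zero)

text \<open>Equalities of functions rather than of values, so that they can be differentiated
  again.\<close>

lemma partial_torus_map:
  "partial 1 (torus_map A B C) = (\<lambda>u. vector [- A * sin (u$1), A * cos (u$1), 0, 0, 0])"
  "partial 2 (torus_map A B C) = (\<lambda>u. vector [0, 0, - B * sin (u$2), B * cos (u$2), 0])"
  unfolding partial_def torus_map_def
  by (rule ext, rule vector_derivative_at, rule has_vector_derivative_vector5;
      auto intro!: derivative_eq_intros simp: axis_def)+

lemma partial2_torus_map:
  "partial 1 (partial 1 (torus_map A B C)) u = vector [- A * cos (u$1), - A * sin (u$1), 0, 0, 0]"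
  "partial 2 (partial 2 (torus_map A B C)) u = vector [0, 0, - B * cos (u$2), - B * sin (u$2), 0]"
  unfolding partial_torus_map unfolding partial_def
  by (rule vector_derivative_at, rule has_vector_derivative_vector5;
      auto intro!: derivative_eq_intros simp: axis_def)+

text \<open>\<open>matrix_inv\<close> is a Hilbert choice; uniqueness of two-sided inverses
  identifies the chosen matrix.\<close>

lemma matrix_inv_unique:
  fixes A :: "'a::semiring_1^'n^'m"
  assumes "A ** B = mat 1" "B ** A = mat 1"
  shows "matrix_inv A = B"
  unfolding matrix_inv_def
proof (rule some_equality)
  show "A ** B = mat 1 \<and> B ** A = mat 1" using assms by simp
  fix B' assume "A ** B' = mat 1 \<and> B' ** A = mat 1"
  then show "B' = B" using assms by (metis matrix_mul_assoc matrix_mul_lid matrix_mul_rid)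
qed

lemma matrix_inv_torus_metric: "matrix_inv (torus_metric u) = (\<chi> i j. if i = j then 4 else 0)"
  by (rule matrix_inv_unique)
     (simp_all add: torus_metric_def matrix_matrix_mult_def mat_def vec_eq_iff forall_2 sum_2)

lemma christoffel_torus_metric: "christoffel torus_metric k i j u = 0"
  by (simp add: christoffel_def partial_def torus_metric_def)

text \<open>The Laplacian \<open>L\<close> has squared length \<open>1 - C\<^sup>2\<close> and
  normal component \<open>-(1 - C\<^sup>2)\<close>. By Pythagoras its tangential part has squared
  length \<open>C\<^sup>2 * (1 - C\<^sup>2)\<close>; the inverse metric contributes the factor 4,
  squared to 16.\<close>

lemma norm_tension_field_torus_map:
  assumes "A\<^sup>2 + B\<^sup>2 + C\<^sup>2 = 1"
  shows "(norm (tension_field torus_metric (sphere 0 1) (torus_map A B C) u))\<^sup>2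
    = 16 * (C\<^sup>2 * (1 - C\<^sup>2))"
proof -
  let ?f = "torus_map A B C u"
  define L where "L = torus_map (- A) (- B) 0 u"
  have nf: "norm ?f = 1" using torus_map_in_sphere[OF assms] by simp
  then have ff: "?f \<bullet> ?f = 1" by (simp add: dot_square_norm)
  have L: "partial 1 (partial 1 (torus_map A B C)) u + partial 2 (partial 2 (torus_map A B C)) u = L"
    by (simp add: partial2_torus_map L_def torus_map_def vec5_eq_iff)
  have "tension_field torus_metric (sphere 0 1) (torus_map A B C) u = 4 *\<^sub>R (L - (L \<bullet> ?f) *\<^sub>R ?f)"
    unfolding L[symmetric]
    by (simp add: tension_field_def matrix_inv_torus_metric sum_2 nabla_d_def
        christoffel_torus_metric pullback_connection_def tangential_part_sphere[OF nf]
        inner_add_left algebra_simps)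
  then have "(norm (tension_field torus_metric (sphere 0 1) (torus_map A B C) u))\<^sup>2
      = 16 * ((L - (L \<bullet> ?f) *\<^sub>R ?f) \<bullet> (L - (L \<bullet> ?f) *\<^sub>R ?f))"
    by (simp add: power_mult_distrib flip: power2_norm_eq_inner)
  also have "(L - (L \<bullet> ?f) *\<^sub>R ?f) \<bullet> (L - (L \<bullet> ?f) *\<^sub>R ?f) = L \<bullet> L - (L \<bullet> ?f)\<^sup>2"
    by (simp add: inner_diff_left inner_diff_right ff inner_commute[of ?f L] power2_eq_square)
  also have "L \<bullet> L = 1 - C\<^sup>2"
    using norm_torus_map[of "- A" "- B" 0 u] assms by (simp add: L_def power2_norm_eq_inner)
  also have "L \<bullet> ?f = - (1 - C\<^sup>2)"
  proof -
    \<comment> \<open>\<open>L\<close> is the negative of the map except in the constant last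
      coordinate, so the inner product needs only \<open>ff\<close> and that coordinate.\<close>
    have "L = C *\<^sub>R axis 5 1 - ?f"
      by (simp add: L_def torus_map_def vec5_eq_iff axis_def)
    then have "L \<bullet> ?f = C * (?f $ 5) - 1"
      by (simp add: inner_diff_left ff inner_axis')
    then show ?thesis by (simp add: torus_map_def power2_eq_square)
  qed
  finally show ?thesis by (simp add: power2_eq_square algebra_simps)
qed

text \<open>The integrand is constant: the factor 8 is half of 16, and the area is
  \<open>(1/4) * (2 * pi)\<^sup>2 = pi\<^sup>2\<close>.\<close>

lemma bienergy_torus_map:
  assumes "A\<^sup>2 + B\<^sup>2 + C\<^sup>2 = 1"
  shows "bienergy torus_metric (cbox (vector [0, 0]) (vector [2 * pi, 2 * pi])) (sphere 0 1)
      (torus_map A B C) = 8 * pi\<^sup>2 * (C\<^sup>2 * (1 - C\<^sup>2))"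
proof -
  have det: "det (torus_metric u) = 1 / 16" for u
    by (simp add: det_2 torus_metric_def)
  have "measure lborel (cbox (vector [0, 0]) (vector [2 * pi, 2 * pi]) :: (real^2) set)
      = (2 * pi) * (2 * pi)"
    by (subst content_cbox_cart)
       (auto simp: UNIV_2 interval_ne_empty_cart forall_2)
  then show ?thesis
    unfolding bienergy_def norm_tension_field_torus_map[OF assms] det
    by (simp add: real_sqrt_divide power2_eq_square)
qed

section \<open>A quotient rule, and the angular parametrization of the torus\<close>

lemma has_derivative_over_power_one_plus_square:
  fixes p :: "real \<Rightarrow> real"
  assumes "(p has_real_derivative p') (at t)"
    and "r = p' * (1 + t\<^sup>2) - 2 * real n * t * p t"
  shows "((\<lambda>t. p t / (1 + t\<^sup>2) ^ n) has_real_derivative r / (1 + t\<^sup>2) ^ Suc n) (at t)"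
proof -
  have nz: "1 + t\<^sup>2 \<noteq> 0" by (metis add_pos_nonneg less_irrefl zero_le_power2 zero_less_one)
  let ?q = "1 + t\<^sup>2"
  have "((\<lambda>t. p t / (1 + t\<^sup>2) ^ n) has_real_derivative
      (p' * ?q ^ n - p t * (real n * ?q ^ (n - 1) * (2 * t))) / (?q ^ n * ?q ^ n)) (at t)"
    using nz by (auto intro!: derivative_eq_intros assms(1))
  \<comment> \<open>Cancelling the common power of \<open>?q\<close> raises the denominator's
    exponent by only one. The case split handles the truncated \<open>n - 1\<close> at
    \<open>n = 0\<close>.\<close>
  moreover have "p' * ?q ^ n - p t * (real n * ?q ^ (n - 1) * (2 * t)) = r * ?q ^ n / ?q"
    unfolding assms(2) using nz by (cases n) (simp_all add: left_diff_distrib diff_divide_distrib)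
  ultimately show ?thesis using nz by (simp add: mult.assoc)
qed

text \<open>Carries sphere membership from angular points, where the maps are given explicitly, to
  all of \<open>torus\<close>.\<close>

lemma torus_point_surj:
  assumes "x \<in> torus"
  obtains \<gamma> \<theta> where "x = torus_point (vector [\<gamma>, \<theta>])"
proof -
  have *: "\<exists>\<alpha>. y = vector [(1/2) * cos \<alpha>, (1/2) * sin \<alpha>]" if "y \<in> sphere 0 (1/2)" for y :: "real^2"
  proof -
    have "y \<bullet> y = (1/2)\<^sup>2" using that by (simp add: dot_square_norm)
    then have "(2 * y$1)\<^sup>2 + (2 * y$2)\<^sup>2 = 1"
      by (simp add: inner_vec_def sum_2 power2_eq_square)
    then obtain \<alpha> where "2 * y$1 = cos \<alpha>" "2 * y$2 = sin \<alpha>"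
      using sincos_total_2pi by metis
    then have "y = vector [(1/2) * cos \<alpha>, (1/2) * sin \<alpha>]"
      by (simp add: vec_eq_iff forall_2 flip: \<open>2 * y$1 = cos \<alpha>\<close> \<open>2 * y$2 = sin \<alpha>\<close>)
    then show ?thesis by blast
  qed
  obtain \<gamma> \<theta> where "fst x = vector [(1/2) * cos \<gamma>, (1/2) * sin \<gamma>]"
      "snd x = vector [(1/2) * cos \<theta>, (1/2) * sin \<theta>]"
    using assms * by (metis mem_Times_iff torus_def)
  then show ?thesis
    using that[of \<gamma> \<theta>] by (simp add: torus_point_def prod_eq_iff)
qed

lemma torus_point_in_torus: "torus_point u \<in> torus"
proof -
  have "norm (vector [(1/2) * cos \<alpha>, (1/2) * sin \<alpha>] :: real^2) = 1/2" for \<alpha> :: real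
  proof (rule power2_eq_imp_eq)
    have "(norm (vector [(1/2) * cos \<alpha>, (1/2) * sin \<alpha>] :: real^2))\<^sup>2
        = ((1/2) * cos \<alpha>)\<^sup>2 + ((1/2) * sin \<alpha>)\<^sup>2"
      unfolding power2_norm_eq_inner inner_vec_def sum_2 vector_2 inner_real_def
      by (simp only: power2_eq_square)
    also have "\<dots> = (1/2)\<^sup>2"
      unfolding power_mult_distrib distrib_left[symmetric] by simp
    finally show "(norm (vector [(1/2) * cos \<alpha>, (1/2) * sin \<alpha>] :: real^2))\<^sup>2 = (1/2)\<^sup>2" .
  qed simp_all
  then show ?thesis by (simp add: torus_def torus_point_def)
qed

theorem theorem3p3:
  fixes \<Phi> V :: "torus_ambient \<Rightarrow> real^5"
    and \<Phi>t :: "real \<Rightarrow> torus_ambient \<Rightarrow> real^5"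
    and E :: "real \<Rightarrow> real"
  assumes \<Phi>: "\<And>\<gamma> \<theta>. \<Phi> (torus_point (vector [\<gamma>, \<theta>])) =
        vector [(1/2) * cos \<gamma>, (1/2) * sin \<gamma>, (1/2) * cos \<theta>, (1/2) * sin \<theta>, 1 / sqrt 2]"
    and V: "\<And>\<gamma> \<theta>. V (torus_point (vector [\<gamma>, \<theta>])) =
        (1 / sqrt 2) *\<^sub>R vector [cos \<gamma>, sin \<gamma>, - cos \<theta>, - sin \<theta>, 0]"
    and \<Phi>t: "\<And>t x. x \<in> torus \<Longrightarrow> \<Phi>t t x = (1 / sqrt (1 + t\<^sup>2)) *\<^sub>R (\<Phi> x + t *\<^sub>R V x)"
    and E: "\<And>t. E t = torus_bienergy (sphere 0 1) (\<Phi>t t)"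
  shows "\<Phi> \<in> torus \<rightarrow> sphere 0 1 \<and>
    (\<forall>t. \<Phi>t t \<in> torus \<rightarrow> sphere 0 1) \<and>
    (\<forall>x\<in>torus. ((\<lambda>t. \<Phi>t t x) has_vector_derivative V x) (at 0)) \<and>
    (\<forall>l<4. \<forall>t. (deriv ^^ l) E field_differentiable (at t)) \<and>
    (\<forall>l\<in>{1, 2, 3}. (deriv ^^ l) E 0 = 0) \<and>
    (deriv ^^ 4) E 0 = - 48 * pi\<^sup>2 \<and> - 48 * pi\<^sup>2 < 0"
proof -
  \<comment> \<open>\<open>A\<close>, \<open>B\<close> and \<open>C\<close> are the two radii and
    the constant coordinate of \<open>\<Phi>t t\<close>, read off from its formula.\<close>
  define A where "A t = (1/2 + t / sqrt 2) / sqrt (1 + t\<^sup>2)" for t :: real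
  define B where "B t = (1/2 - t / sqrt 2) / sqrt (1 + t\<^sup>2)" for t :: real
  define C where "C t = (1 / sqrt 2) / sqrt (1 + t\<^sup>2)" for t :: real
  have pos: "1 + t\<^sup>2 > 0" for t :: real by (simp add: add_pos_nonneg)
  have C2: "(C t)\<^sup>2 = 1 / (2 * (1 + t\<^sup>2))" for t
    using pos[of t] by (simp add: C_def power_divide power_mult_distrib)
  have ABC: "(A t)\<^sup>2 + (B t)\<^sup>2 + (C t)\<^sup>2 = 1" for t
  proof -
    have "(A t)\<^sup>2 + (B t)\<^sup>2 + (C t)\<^sup>2 =
        ((1/2 + t / sqrt 2)\<^sup>2 + (1/2 - t / sqrt 2)\<^sup>2 + (1 / sqrt 2)\<^sup>2) / (1 + t\<^sup>2)"
      by (simp only: A_def B_def C_def power_divide[of _ "sqrt (1 + t\<^sup>2)"]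
          real_sqrt_pow2[OF less_imp_le[OF pos]] add_divide_distrib[of _ _ "1 + t\<^sup>2"])
    also have "(1/2 + t / sqrt 2)\<^sup>2 + (1/2 - t / sqrt 2)\<^sup>2 + (1 / sqrt 2)\<^sup>2 = 1 + t\<^sup>2"
      by (simp add: power2_sum power2_diff power_divide)
    finally show ?thesis using pos[of t] by simp
  qed
  have param: "\<Phi>t t (torus_point u) = torus_map (A t) (B t) (C t) u" for t u
  proof -
    have u: "vector [u$1, u$2] = u" by (simp add: vec_eq_iff forall_2)
    show ?thesis
      unfolding \<Phi>t[OF torus_point_in_torus]
        \<Phi>[of "u$1" "u$2", unfolded u] V[of "u$1" "u$2", unfolded u]
      by (simp add: torus_map_def A_def B_def C_def vec5_eq_iff
          add_divide_distrib diff_divide_distrib algebra_simps)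
  qed
  have Et: "E t = 2 * pi\<^sup>2 * (1 + 2 * t\<^sup>2) / (1 + t\<^sup>2) ^ 2" for t
  proof -
    have "E t = 8 * pi\<^sup>2 * ((C t)\<^sup>2 * (1 - (C t)\<^sup>2))"
      unfolding E torus_bienergy_def comp_def param by (rule bienergy_torus_map[OF ABC])
    \<comment> \<open>Here \<open>q\<close> stands for \<open>1 + t\<^sup>2\<close>, and
      \<open>1 / (2 * q)\<close> is the value of \<open>(C t)\<^sup>2\<close>.\<close>
    moreover have "8 * pi\<^sup>2 * (1 / (2 * q) * (1 - 1 / (2 * q))) = 2 * pi\<^sup>2 * (2 * q - 1) / q ^ 2"
      if "q > 0" for q :: real
      using that by (simp add: field_simps power2_eq_square)
    moreover have "1 + 2 * t\<^sup>2 = 2 * (1 + t\<^sup>2) - 1" by simp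
    ultimately show ?thesis
      using C2 pos[of t] by (simp only:)
  qed
  have sphere_t: "\<Phi>t t \<in> torus \<rightarrow> sphere 0 1" for t
  proof
    fix x assume "x \<in> torus"
    then obtain \<gamma> \<theta> where "x = torus_point (vector [\<gamma>, \<theta>])" by (rule torus_point_surj)
    then show "\<Phi>t t x \<in> sphere 0 1" using param torus_map_in_sphere[OF ABC] by simp
  qed
  have "\<Phi>t 0 x = \<Phi> x" if "x \<in> torus" for x
    using \<Phi>t[OF that, of 0] by simp
  then have sphere_0: "\<Phi> \<in> torus \<rightarrow> sphere 0 1"
    using sphere_t[of 0] by (auto simp: Pi_iff)
  have deriv_\<Phi>t: "((\<lambda>t. \<Phi>t t x) has_vector_derivative V x) (at 0)" if "x \<in> torus" for x
    unfolding \<Phi>t[OF that] using has_vector_derivative_normalized_line[of 1 "\<Phi> x" "V x"] by simp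
  \<comment> \<open>\<open>P l\<close> is the numerator of the \<open>l\<close>-th derivative of \<open>E\<close> over \<open>(1 + t\<^sup>2) ^ (l + 2)\<close>, and \<open>P' l\<close> is its
    derivative.\<close>
  define P :: "nat \<Rightarrow> real \<Rightarrow> real" where "P l t = 2 * pi\<^sup>2 * [1 + 2 * t\<^sup>2, - 4 * t ^ 3,
      12 * t ^ 4 - 12 * t\<^sup>2, - 48 * t ^ 5 + 120 * t ^ 3 - 24 * t,
      240 * t ^ 6 - 1080 * t ^ 4 + 576 * t\<^sup>2 - 24] ! l" for l t
  define P' :: "nat \<Rightarrow> real \<Rightarrow> real" where "P' l t = 2 * pi\<^sup>2 * [4 * t, - 12 * t\<^sup>2,
      48 * t ^ 3 - 24 * t, - 240 * t ^ 4 + 360 * t\<^sup>2 - 24] ! l" for l t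
  define D where "D l t = P l t / (1 + t\<^sup>2) ^ (l + 2)" for l t
  have less4: "l < 4 \<longleftrightarrow> l = 0 \<or> l = 1 \<or> l = 2 \<or> l = 3" for l :: nat by auto
  have step: "(D l has_real_derivative D (Suc l) t) (at t)" if "l < 4" for l t
    unfolding D_def add_Suc
  proof (rule has_derivative_over_power_one_plus_square)
    show "(P l has_real_derivative P' l t) (at t)"
      using that unfolding less4 P_def P'_def
      by (elim disjE; hypsubst; simp; auto intro!: derivative_eq_intros)
    show "P (Suc l) t = P' l t * (1 + t\<^sup>2) - 2 * real (l + 2) * t * P l t"
      using that unfolding less4 P_def P'_def
      by (elim disjE; hypsubst; simp; simp add: algebra_simps eval_nat_numeral)
  qed
  have iter: "(deriv ^^ l) E = D l" if "l \<le> 4" for l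
    using that
  proof (induction l)
    case 0
    show ?case by (simp add: fun_eq_iff Et D_def P_def power2_eq_square)
  next
    case (Suc l)
    then have "(deriv ^^ Suc l) E = deriv (D l)" by simp
    also have "\<dots> = D (Suc l)"
      using Suc.prems by (intro ext DERIV_imp_deriv step) simp
    finally show ?case .
  qed
  \<comment> \<open>\<open>deriv\<close> is a choice even where no derivative exists;
    differentiability makes the iterated values genuine derivatives.\<close>
  have "\<forall>l<4. \<forall>t. (deriv ^^ l) E field_differentiable (at t)"
    using iter step by (metis field_differentiable_def less_imp_le)
  \<comment> \<open>At 0 the denominator is 1, so only the constant terms of \<open>P l\<close>
    survive: none for \<open>l = 1, 2, 3\<close>, and \<open>2 * pi\<^sup>2 * (-24)\<close> for
    \<open>l = 4\<close>.\<close>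
  moreover have "\<forall>l\<in>{1, 2, 3}. (deriv ^^ l) E 0 = 0" "(deriv ^^ 4) E 0 = - 48 * pi\<^sup>2"
    by (auto simp: iter D_def P_def simp del: funpow.simps)
  ultimately show ?thesis
    using sphere_0 sphere_t deriv_\<Phi>t by auto
qed

end
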